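(* Let $X$ be a topological space. If $X$ satisfies well-ordered $(\alpha A)$ for some ordinal $\alpha$, then $X$ is a $D$-space.
   Context: **$D$-space.** An open neighborhood assignment (ONA) on a space $(X,\tau)$ is a function $N : X \to \tau$ such that $x \in N(x)$ for all $x \in X$. The space $X$ is a $D$-space iff for every ONA $N$ on $X$ there is a closed discrete subset $D$ of $X$ such that $\{N(d) : d \in D\}$ covers $X$. **Well-ordered $(\alpha A)$.** Let $X$ be a space and $\alpha$ an ordinal. $X$ satisfies $(\alpha A)$ iff there is $\mathcal{W} = \{\mathcal{W}(x) : x \in X\}$, where $\mathcal{W}(x) = \{W(\beta,x) : \beta < \alpha\}$, such that $x \in W(\beta,x) \subseteq X$ (the sets $W(\beta,x)$ need not be open), with the following property: for every $x \in X$ and every open set $U$ containing $x$ there exist an open set $V(x,U)$ containing $x$ and an ordinal $\beta = \varphi(x,U) < \alpha$ such that $$x \in W(\beta,y) \subseteq U \quad\text{for all } y \in V(x,U).$$ If, in addition, $W(\beta,x) \subseteq W(\gamma,x)$ whenever $\gamma < \beta < \alpha$ (for every $x \in X$), then $X$ satisfies well-ordered $(\alpha A)$.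
   Formalization: The space X is additionally assumed to be T0; for arbitrary topological spaces the claim fails, e.g. for the two-point indiscrete space with α = 1 and W(0,x) = X, which satisfies well-ordered (αA) but is not a D-space. *)

theory Defs
  imports "HOL-Analysis.Analysis"
begin

definition open_nbhd_assignment :: "'a topology \<Rightarrow> ('a \<Rightarrow> 'a set) \<Rightarrow> bool" where
  "open_nbhd_assignment X N \<longleftrightarrow> (\<forall>x \<in> topspace X. openin X (N x) \<and> x \<in> N x)"

definition D_space :: "'a topology \<Rightarrow> bool" where
  "D_space X \<longleftrightarrow>
     (\<forall>N. open_nbhd_assignment X N \<longrightarrow>
        (\<exists>D. closedin X D \<and> subtopology X D = discrete_topology D \<and>
             topspace X \<subseteq> (\<Union>d\<in>D. N d)))"

(* An ordinal is represented by a well-order r on an arbitrary type: the ordinals below it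
   are the elements of Field r, and gamma < beta is rendered as gamma : underS r beta.
   Order_Relation.underS r beta is the set of strict predecessors of beta. The empty
   well-order (the ordinal 0) is included. *)

definition alpha_A_system :: "'b rel \<Rightarrow> 'a topology \<Rightarrow> ('b \<Rightarrow> 'a \<Rightarrow> 'a set) \<Rightarrow> bool" where
  "alpha_A_system \<alpha> X W \<longleftrightarrow>
     (\<forall>x \<in> topspace X. \<forall>\<beta> \<in> Field \<alpha>. x \<in> W \<beta> x \<and> W \<beta> x \<subseteq> topspace X) \<and>
     (\<forall>x \<in> topspace X. \<forall>U. openin X U \<and> x \<in> U \<longrightarrow>
        (\<exists>V. openin X V \<and> x \<in> V \<and>
           (\<exists>\<beta> \<in> Field \<alpha>. \<forall>y \<in> V. x \<in> W \<beta> y \<and> W \<beta> y \<subseteq> U)))"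

definition satisfies_alpha_A :: "'b rel \<Rightarrow> 'a topology \<Rightarrow> bool" where
  "satisfies_alpha_A \<alpha> X \<longleftrightarrow> (\<exists>W. alpha_A_system \<alpha> X W)"

definition satisfies_well_ordered_alpha_A :: "'b rel \<Rightarrow> 'a topology \<Rightarrow> bool" where
  "satisfies_well_ordered_alpha_A \<alpha> X \<longleftrightarrow>
     (\<exists>W. alpha_A_system \<alpha> X W \<and>
        (\<forall>x \<in> topspace X. \<forall>\<beta> \<in> Field \<alpha>. \<forall>\<gamma> \<in> Order_Relation.underS \<alpha> \<beta>. W \<beta> x \<subseteq> W \<gamma> x))"

(* A separation axiom is indispensable for "well-ordered (alpha A) implies D-space":
   the two-point indiscrete space satisfies well-ordered (alpha A), with alpha = 1 and
   W(0,x) the whole space, but its only closed discrete subset is empty. *)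

lemma indiscrete_not_D_space:
  fixes X :: "bool topology"
  assumes X: "X = topology (\<lambda>U. U = {} \<or> U = UNIV)"
  shows "satisfies_well_ordered_alpha_A {((), ())} X \<and> \<not> D_space X"
proof -
  have "istopology (\<lambda>U::bool set. U = {} \<or> U = UNIV)"
    unfolding istopology_def by auto
  then have op: "openin X U \<longleftrightarrow> U = {} \<or> U = UNIV" for U
    by (simp add: X topology_inverse')
  have top: "topspace X = UNIV"
    unfolding topspace_def using op by auto
  have "satisfies_well_ordered_alpha_A {((), ())} X"
    unfolding satisfies_well_ordered_alpha_A_def alpha_A_system_def
    by (rule exI[of _ "\<lambda>_ _. UNIV"]) (auto simp: op top Field_def)
  moreover have "\<not> D_space X"
  proof
    assume "D_space X"
    moreover have "open_nbhd_assignment X (\<lambda>_. UNIV)"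
      by (simp add: open_nbhd_assignment_def op)
    ultimately obtain D where D: "closedin X D" "subtopology X D = discrete_topology D"
      and cov: "topspace X \<subseteq> (\<Union>d\<in>D. UNIV)"
      unfolding D_space_def by blast
    from cov have "D \<noteq> {}" by (auto simp: top)
    moreover have "UNIV - D = {} \<or> UNIV - D = UNIV"
      using D(1) by (simp add: closedin_def op top)
    ultimately have "D = UNIV" by auto
    with D(2) have "X = discrete_topology UNIV" by simp
    then have "openin X {True}" by simp
    then show False by (auto simp: op)
  qed
  ultimately show ?thesis by blast
qed

end

(* Call a point x closed if {x} is closed. For T0 spaces, the well-foundedness of the index order
   shows that the closure of every point z contains a closed point: a strictly descending chain
   of points in the closure of z, separated by open sets, would yield strictly decreasing indices.

   Given an assignment N, let b x be an index such that x : W (b x) y and W (b x) y <= N x for all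
   y in an open V x containing x. Well-order the closed points compatibly with b and select
   greedily those not covered by the N d of the earlier selected d. If e is selected, b e <= b x
   and e : V x, then x : W (b x) e <= W (b e) e <= N e. Hence V x misses every selected e which
   precedes x and does not cover it, and this makes the selected set closed and discrete. *)

theory Submission
  imports Defs
begin

lemma t0_exists_closed_point_in_closure:
  fixes X :: "'a topology" and \<alpha> :: "'b rel"
  assumes t0: "t0_space X" and wo: "Well_order \<alpha>" and sys: "alpha_A_system \<alpha> X W"
    and mono: "\<And>x \<beta> \<gamma>. \<lbrakk>x \<in> topspace X; \<beta> \<in> Field \<alpha>; \<gamma> \<in> underS \<alpha> \<beta>\<rbrakk> \<Longrightarrow> W \<beta> x \<subseteq> W \<gamma> x"
    and z: "z \<in> topspace X"
  shows "\<exists>x\<in>X closure_of {z}. closedin X {x}"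
proof (rule ccontr)
  assume "\<not> ?thesis"
  then have not_closed: "\<not> closedin X {x}" if "x \<in> X closure_of {z}" for x
    using that by blast
  have closure_trans: "y \<in> X closure_of {z}"
    if "y \<in> X closure_of {x}" "x \<in> X closure_of {z}" for x y
    using that closure_of_minimal[of "{x}" "X closure_of {z}" X] by auto
  \<comment> \<open>\<open>P \<gamma> x y U\<close> says that U separates x from a point y of its
    closure and that \<gamma> is an index for x and U, read off at z. Taking all sets at the one
    point z makes the indices comparable by monotonicity.\<close>
  define P where "P \<gamma> x y U \<longleftrightarrow> x \<in> X closure_of {z} \<and> y \<in> X closure_of {x} \<and> openin X U \<and>
      x \<in> U \<and> y \<notin> U \<and> \<gamma> \<in> Field \<alpha> \<and> x \<in> W \<gamma> z \<and> W \<gamma> z \<subseteq> U" for \<gamma> x y U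
  have ex: "\<exists>\<gamma> y U. P \<gamma> x y U" if x: "x \<in> X closure_of {z}" for x
  proof -
    have xX: "x \<in> topspace X"
      using x by (simp add: in_closure_of)
    then have "X closure_of {x} \<noteq> {x}" "x \<in> X closure_of {x}"
      using not_closed[OF x] closure_of_eq[of X "{x}"] by (auto simp: in_closure_of)
    then obtain y where y: "y \<in> X closure_of {x}" "y \<noteq> x" by blast
    \<comment> \<open>T0 gives an open set containing exactly one of the two points; this one is x,
      since every open set around y contains x.\<close>
    then obtain U where U: "openin X U" "x \<in> U" "y \<notin> U"
      using t0 xX unfolding t0_space_def by (metis in_closure_of singletonD)
    then obtain V \<gamma> where V: "openin X V" "x \<in> V" "\<gamma> \<in> Field \<alpha>"
        "\<forall>y\<in>V. x \<in> W \<gamma> y \<and> W \<gamma> y \<subseteq> U"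
      using sys xX unfolding alpha_A_system_def by meson
    moreover have "z \<in> V"
      using x V unfolding in_closure_of by blast
    ultimately have "P \<gamma> x y U"
      using x y U unfolding P_def by blast
    then show ?thesis by blast
  qed
  have wf: "wf (\<alpha> - Id)"
    using wo by (simp add: well_order_on_def)
  have "z \<in> X closure_of {z}"
    using z by (auto simp: in_closure_of)
  then obtain \<gamma>0 where "\<gamma>0 \<in> {\<gamma>. \<exists>x y U. P \<gamma> x y U}"
    using ex by blast
  from wfE_min[OF wf this] obtain \<gamma> where "\<gamma> \<in> {\<gamma>. \<exists>x y U. P \<gamma> x y U}"
    and min: "\<And>\<gamma>'. (\<gamma>', \<gamma>) \<in> \<alpha> - Id \<Longrightarrow> \<gamma>' \<notin> {\<gamma>. \<exists>x y U. P \<gamma> x y U}" by blast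
  then obtain x y U where P: "P \<gamma> x y U" by blast
  then have "y \<in> X closure_of {z}"
    unfolding P_def using closure_trans by blast
  then obtain \<gamma>' y' U' where P': "P \<gamma>' y y' U'"
    using ex by blast
  \<comment> \<open>\<open>W \<gamma> z\<close> lies in U and so misses y, whereas
    \<open>W \<gamma>' z\<close> contains y. By monotonicity \<gamma> cannot precede \<gamma>', so
    \<gamma>' is smaller, against minimality.\<close>
  have "y \<notin> W \<gamma> z" "y \<in> W \<gamma>' z" and F: "\<gamma> \<in> Field \<alpha>" "\<gamma>' \<in> Field \<alpha>"
    using P P' unfolding P_def by blast+
  then have "\<gamma> \<noteq> \<gamma>'" and "\<gamma> \<notin> underS \<alpha> \<gamma>'"
    using mono[OF z, of \<gamma>' \<gamma>] by blast+
  then have "(\<gamma>', \<gamma>) \<in> \<alpha> - Id"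
    using wo F unfolding well_order_on_def linear_order_on_def total_on_def underS_def by blast
  then show False
    using min P' by blast
qed

text \<open>Compare values of \<open>f\<close> first and break ties by an arbitrary well-order of
  the type. Totality is claimed only for values in \<open>Field \<alpha>\<close>, where \<alpha>
  itself is total.\<close>

lemma ex_total_wf_refining:
  fixes f :: "'a \<Rightarrow> 'b"
  assumes wo: "Well_order \<alpha>"
  obtains R where "wf R" "trans R"
    "\<And>x y. \<lbrakk>f x \<in> Field \<alpha>; f y \<in> Field \<alpha>; x \<noteq> y\<rbrakk> \<Longrightarrow> (x, y) \<in> R \<or> (y, x) \<in> R"
    "\<And>x y. (x, y) \<in> R \<Longrightarrow> f x = f y \<or> f x \<in> underS \<alpha> (f y)"
proof -
  obtain r :: "'a rel" where r: "well_order_on UNIV r"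
    using well_ordering by metis
  define R where "R = inv_image ((\<alpha> - Id) <*lex*> (r - Id)) (\<lambda>x. (f x, x))"
  show thesis
  proof
    show "wf R"
      using wo r unfolding R_def well_order_on_def by (intro wf_inv_image wf_lex_prod) auto
    have "trans (\<alpha> - Id)" "trans (r - Id)"
      using wo r by (auto simp: well_order_on_def linear_order_on_def partial_order_on_def
          preorder_on_def intro!: trans_diff_Id)
    then show "trans R"
      unfolding R_def by (intro trans_inv_image trans_lex_prod)
    show "(x, y) \<in> R \<or> (y, x) \<in> R" if "f x \<in> Field \<alpha>" "f y \<in> Field \<alpha>" "x \<noteq> y" for x y
      using that wo r unfolding R_def well_order_on_def linear_order_on_def total_on_def
      by auto
    show "f x = f y \<or> f x \<in> underS \<alpha> (f y)" if "(x, y) \<in> R" for x y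
      using that unfolding R_def underS_def by auto
  qed
qed

text \<open>Whether x is selected depends only on which of its \<open>R\<close>-predecessors are
  selected, so membership can be defined by well-founded recursion.\<close>

lemma ex_greedy_subset:
  assumes "wf R"
  obtains D where "D \<subseteq> C" "\<And>x. x \<in> C \<Longrightarrow> x \<in> D \<longleftrightarrow> (\<forall>d\<in>D. (d, x) \<in> R \<longrightarrow> x \<notin> N d)"
proof
  define F where "F g x \<longleftrightarrow> x \<in> C \<and> (\<forall>d. (d, x) \<in> R \<longrightarrow> g d \<longrightarrow> x \<notin> N d)" for g x
  \<comment> \<open>\<open>F\<close> consults its first argument only at
    \<open>R\<close>-predecessors of x, where the cut agrees with the full function.\<close>
  have "wfrec R F x = F (wfrec R F) x" for x
    by (subst wfrec[OF assms]) (auto simp: F_def cut_def)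
  then have eq: "wfrec R F x \<longleftrightarrow> x \<in> C \<and> (\<forall>d. (d, x) \<in> R \<longrightarrow> wfrec R F d \<longrightarrow> x \<notin> N d)" for x
    unfolding F_def .
  show "{x. wfrec R F x} \<subseteq> C"
    using eq by blast
  show "x \<in> {x. wfrec R F x} \<longleftrightarrow> (\<forall>d\<in>{x. wfrec R F x}. (d, x) \<in> R \<longrightarrow> x \<notin> N d)"
    if "x \<in> C" for x
    using that eq[of x] by blast
qed

theorem theorem4p2:
  fixes X :: "'a topology" and \<alpha> :: "'b rel"
  assumes "t0_space X"
    and "Well_order \<alpha>"
    and "satisfies_well_ordered_alpha_A \<alpha> X"
  shows "D_space X"
  unfolding D_space_def
proof (intro allI impI)
  fix N assume "open_nbhd_assignment X N"
  then have N: "openin X (N x)" "x \<in> N x" if "x \<in> topspace X" for x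
    using that by (auto simp: open_nbhd_assignment_def)
  obtain W where sys: "alpha_A_system \<alpha> X W" and
    mono: "\<And>x \<beta> \<gamma>. \<lbrakk>x \<in> topspace X; \<beta> \<in> Field \<alpha>; \<gamma> \<in> underS \<alpha> \<beta>\<rbrakk> \<Longrightarrow> W \<beta> x \<subseteq> W \<gamma> x"
    using assms(3) unfolding satisfies_well_ordered_alpha_A_def by blast
  have "\<forall>x\<in>topspace X. \<exists>V \<beta>. openin X V \<and> x \<in> V \<and> \<beta> \<in> Field \<alpha> \<and>
      (\<forall>y\<in>V. x \<in> W \<beta> y \<and> W \<beta> y \<subseteq> N x)"
    using sys N unfolding alpha_A_system_def by meson
  then obtain V b where V: "\<And>x. x \<in> topspace X \<Longrightarrow> openin X (V x) \<and> x \<in> V x \<and> b x \<in> Field \<alpha>"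
    and VW: "\<And>x y. \<lbrakk>x \<in> topspace X; y \<in> V x\<rbrakk> \<Longrightarrow> x \<in> W (b x) y \<and> W (b x) y \<subseteq> N x"
    by metis
  \<comment> \<open>Selecting closed points only allows one selected point to be removed from an
    open set without losing openness.\<close>
  define C where "C = {x. closedin X {x}}"
  have CX: "x \<in> topspace X" if "x \<in> C" for x
    using that closedin_subset unfolding C_def by blast
  obtain R where R: "wf R" "trans R"
    and tot: "\<And>x y. \<lbrakk>b x \<in> Field \<alpha>; b y \<in> Field \<alpha>; x \<noteq> y\<rbrakk> \<Longrightarrow> (x, y) \<in> R \<or> (y, x) \<in> R"
    and R_b: "\<And>x y. (x, y) \<in> R \<Longrightarrow> b x = b y \<or> b x \<in> underS \<alpha> (b y)"
    using ex_total_wf_refining[OF assms(2), of b] by metis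
  obtain D where DC: "D \<subseteq> C"
    and D: "\<And>x. x \<in> C \<Longrightarrow> x \<in> D \<longleftrightarrow> (\<forall>d\<in>D. (d, x) \<in> R \<longrightarrow> x \<notin> N d)"
    using ex_greedy_subset[OF R(1), of C N] by metis
  have cover_C: "\<exists>d\<in>D. x \<in> N d \<and> (d = x \<or> (d, x) \<in> R)" if "x \<in> C" for x
    using that D[OF that] N CX by blast
  \<comment> \<open>An open set that covers the closed point x' also covers x, so covering
    \<open>C\<close> is enough.\<close>
  have pt: "\<exists>x'\<in>C. \<forall>U. openin X U \<longrightarrow> x' \<in> U \<longrightarrow> x \<in> U" if x: "x \<in> topspace X" for x
  proof -
    obtain x' where "x' \<in> X closure_of {x}" "closedin X {x'}"
      using t0_exists_closed_point_in_closure[OF assms(1,2) sys mono x] by auto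
    then show ?thesis
      unfolding C_def in_closure_of by blast
  qed
  have cover: "topspace X \<subseteq> (\<Union>d\<in>D. N d)"
  proof
    fix x assume "x \<in> topspace X"
    then obtain x' where "x' \<in> C" "\<And>U. openin X U \<Longrightarrow> x' \<in> U \<Longrightarrow> x \<in> U"
      using pt by blast
    then show "x \<in> (\<Union>d\<in>D. N d)"
      using cover_C[of x'] DC CX N by blast
  qed
  have W_less: "x \<in> N e"
    if "e \<in> V x" "(e, x) \<in> R" "x \<in> topspace X" "e \<in> topspace X" for e x
  proof -
    have "x \<in> W (b x) e"
      using VW that by blast
    also have "\<dots> \<subseteq> W (b e) e"
      using R_b[OF that(2)] mono[OF that(4), of "b x" "b e"] V[OF that(3)] by auto
    also have "\<dots> \<subseteq> N e"
      using VW V that by blast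
    finally show ?thesis .
  qed
  \<comment> \<open>If \<open>D\<close> accumulates at x, let d be the \<open>R\<close>-least
    selected point whose \<open>N d\<close> contains x. A selected e near x is found with x' before
    e before d; the selected c covering x' then precedes d and covers x.\<close>
  have "x \<notin> X derived_set_of D" for x
  proof
    assume xd: "x \<in> X derived_set_of D"
    then have x: "x \<in> topspace X"
      by (simp add: in_derived_set_of)
    then obtain x' where x': "x' \<in> C" and sp: "\<And>U. openin X U \<Longrightarrow> x' \<in> U \<Longrightarrow> x \<in> U"
      using pt by blast
    obtain d0 where "d0 \<in> {d \<in> D. x \<in> N d}"
      using cover x by blast
    from wfE_min[OF R(1) this] obtain d where d: "d \<in> D" "x \<in> N d"
      and least: "\<And>e. (e, d) \<in> R \<Longrightarrow> e \<in> D \<Longrightarrow> x \<notin> N e"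
      by (metis (no_types, lifting) mem_Collect_eq)
    have dC: "d \<in> C" and d_closed: "closedin X {d}"
      using d DC C_def by auto
    \<comment> \<open>The case split keeps x in \<open>T\<close> and forces any point of
      \<open>T\<close> other than x to differ from d.\<close>
    define T where "T = (if x = d then N d \<inter> V x' else N d \<inter> V x' - {d})"
    have "openin X T" "x \<in> T"
      using d d_closed N V[OF CX[OF x']] sp[of "V x'"] CX[OF dC] unfolding T_def by auto
    then obtain e where e: "e \<in> D" "e \<noteq> x" "e \<in> T"
      using xd unfolding in_derived_set_of by blast
    then have e': "e \<noteq> d" "e \<in> N d" "e \<in> V x'" and eC: "e \<in> C"
      using DC unfolding T_def by (auto split: if_splits)
    \<comment> \<open>As e is selected and lies in \<open>N d\<close>, d cannot precede it.\<close>
    have "(d, e) \<notin> R"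
      using D[OF eC] e e' d by blast
    then have ed: "(e, d) \<in> R"
      using tot[of d e] V CX dC eC e' by blast
    then have xe: "x \<notin> N e"
      using least e by blast
    then have x'e: "x' \<notin> N e"
      using sp N CX eC by blast
    then have "e \<noteq> x'"
      using N CX eC by blast
    \<comment> \<open>Since e lies in \<open>V x'\<close>, its preceding x' would put x' into
      \<open>N e\<close> by \<open>W_less\<close>.\<close>
    moreover have "(e, x') \<notin> R"
      using W_less x'e e' CX x' eC by blast
    ultimately have "(x', e) \<in> R"
      using tot[of x' e] V CX x' eC by blast
    then have x'd: "(x', d) \<in> R"
      using ed R(2) by (blast dest: transD)
    obtain c where c: "c \<in> D" "x' \<in> N c" "c = x' \<or> (c, x') \<in> R"
      using cover_C[OF x'] by blast
    then have "(c, d) \<in> R"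
      using x'd R(2) by (blast dest: transD)
    moreover have "x \<in> N c"
      using sp[OF N(1)] c DC CX by blast
    ultimately show False
      using least c by blast
  qed
  then have "X derived_set_of D = {}" by blast
  moreover have "D \<subseteq> topspace X"
    using DC CX by blast
  ultimately have "closedin X D" "subtopology X D = discrete_topology D"
    by (auto simp: closedin_contains_derived_set subtopology_eq_discrete_topology_eq)
  with cover show "\<exists>D. closedin X D \<and> subtopology X D = discrete_topology D \<and>
      topspace X \<subseteq> (\<Union>d\<in>D. N d)"
    by blast
qed

end
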